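(* Let $\varphi$ be a Ma-Minda function with $\varphi(z)=1+B_1z+B_2z^2+B_3z^3+\cdots$, and let $f\in\mathcal{S}^*(\varphi)$. Put $$\sigma_3=\frac{2(B_2-3B_1^2)}{B_1},\qquad \mu_3=\frac{8B_1^3-6B_1B_2+B_3}{B_1}.$$ If $(\sigma_3,\mu_3)\in\Omega_2\cup\Omega_3$ and $B_1\le|3B_1^2-B_2|$, then $$|T_{2,2}(f^{-1})|=|b_3^2-b_4^2|\le\frac{(B_2-3B_1^2)^2}{4}+\frac{(8B_1^3-6B_1B_2+B_3)^2}{9}.$$ The estimate is sharp (for each such $\varphi$, equality is attained by some $f\in\mathcal{S}^*(\varphi)$).
   Context: $\mathbb{U}=\{z\in\mathbb{C}:|z|<1\}$, and $\mathcal{A}$ is the class of analytic functions $f$ on $\mathbb{U}$ of the form $f(z)=z+\sum_{n\ge2}a_nz^n$. For analytic $g,h$ on $\mathbb{U}$, $g\prec h$ (subordination) means there is an analytic $\omega:\mathbb{U}\to\mathbb{C}$ with $\omega(0)=0$, $|\omega(z)|\le1$, and $g=h\circ\omega$. A Ma-Minda function is an analytic univalent $\varphi$ on $\mathbb{U}$ with $\varphi(0)=1$, $\varphi'(0)>0$, mapping $\mathbb{U}$ onto a domain in the right half-plane that is symmetric about the real axis and starlike with respect to $\varphi(0)=1$ (so $B_1>0$ and all $B_n$ are real). $\mathcal{S}^*(\varphi)=\{f\in\mathcal{A}: zf'(z)/f(z)\prec\varphi(z)\}$; its members are univalent. The local inverse near $0$ is written $f^{-1}(w)=w+\sum_{n\ge2}b_nw^n$;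 thus $b_3=-a_3+2a_2^2$, $b_4=-5a_2^3+5a_2a_3-a_4$. Definition: $T_{2,2}(f^{-1})=b_3^2-b_4^2$. Regions in $\mathbb{R}^2$: $\Omega_2=\{(\sigma,\mu):2\le|\sigma|\le4,\ \mu\ge\frac1{12}(\sigma^2+8)\}$, $\Omega_3=\{(\sigma,\mu):|\sigma|\ge4,\ \mu\ge\frac23(|\sigma|-1)\}$. *)

theory Defs
  imports "HOL-Complex_Analysis.Complex_Analysis"
begin

definition taylor_coeff :: "(complex \<Rightarrow> complex) \<Rightarrow> nat \<Rightarrow> complex" where
  "taylor_coeff f n = fps_nth (fps_expansion f 0) n"

definition class_A :: "(complex \<Rightarrow> complex) set" where
  "class_A = {f. f holomorphic_on ball 0 1 \<and> f 0 = 0 \<and> deriv f 0 = 1}"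

definition subordinate :: "(complex \<Rightarrow> complex) \<Rightarrow> (complex \<Rightarrow> complex) \<Rightarrow> bool"
  (infix \<open>\<prec>\<^sub>U\<close> 50) where
  "g \<prec>\<^sub>U h \<longleftrightarrow> g holomorphic_on ball 0 1 \<and> h holomorphic_on ball 0 1 \<and>
     (\<exists>\<omega>. \<omega> holomorphic_on ball 0 1 \<and> \<omega> 0 = 0 \<and> (\<forall>z\<in>ball 0 1. cmod (\<omega> z) \<le> 1) \<and>
          (\<forall>z\<in>ball 0 1. g z = h (\<omega> z)))"

definition ma_minda :: "(complex \<Rightarrow> complex) \<Rightarrow> bool" where
  "ma_minda \<phi> \<longleftrightarrow>
     \<phi> holomorphic_on ball 0 1 \<and> inj_on \<phi> (ball 0 1) \<and>
     \<phi> 0 = 1 \<and> Im (deriv \<phi> 0) = 0 \<and> Re (deriv \<phi> 0) > 0 \<and>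
     \<phi> ` ball 0 1 \<subseteq> {w. Re w > 0} \<and>
     cnj ` (\<phi> ` ball 0 1) = \<phi> ` ball 0 1 \<and>
     (\<forall>w\<in>\<phi> ` ball 0 1. closed_segment 1 w \<subseteq> \<phi> ` ball 0 1)"

text \<open>The coefficients of a Ma-Minda function are real by the symmetry of its image
  (see \<open>ma_minda_coeff_real\<close> below), so taking real parts loses nothing.\<close>

definition mm_coeff :: "(complex \<Rightarrow> complex) \<Rightarrow> nat \<Rightarrow> real" where
  "mm_coeff \<phi> n = Re (taylor_coeff \<phi> n)"

text \<open>For \<open>f \<in> class_A\<close> the quotient \<open>z f'(z) / f(z)\<close> has a removable singularity at \<open>0\<close> with
  value \<open>1\<close>. Other zeros of \<open>f\<close> in the disc are excluded because the quotient would be \<open>0\<close> there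
  by the convention \<open>x / 0 = 0\<close>, whereas \<open>\<phi>\<close> takes values in the right half-plane.\<close>

definition starlike_quotient :: "(complex \<Rightarrow> complex) \<Rightarrow> complex \<Rightarrow> complex" where
  "starlike_quotient f z = (if z = 0 then 1 else z * deriv f z / f z)"

definition starlike_class :: "(complex \<Rightarrow> complex) \<Rightarrow> (complex \<Rightarrow> complex) set" where
  "starlike_class \<phi> = {f \<in> class_A. starlike_quotient f \<prec>\<^sub>U \<phi>}"

definition is_local_inverse :: "(complex \<Rightarrow> complex) \<Rightarrow> (complex \<Rightarrow> complex) \<Rightarrow> bool" where
  "is_local_inverse f g \<longleftrightarrow> g analytic_on {0} \<and> g 0 = 0 \<and>
     (\<forall>\<^sub>F w in nhds 0. f (g w) = w) \<and> (\<forall>\<^sub>F z in nhds 0. g (f z) = z)"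

text \<open>Two local inverses agree near \<open>0\<close>, hence the coefficients do not depend on the choice.\<close>

definition inverse_coeff :: "(complex \<Rightarrow> complex) \<Rightarrow> nat \<Rightarrow> complex" where
  "inverse_coeff f n = taylor_coeff (SOME g. is_local_inverse f g) n"

definition T22_inverse :: "(complex \<Rightarrow> complex) \<Rightarrow> complex" where
  "T22_inverse f = (inverse_coeff f 3)^2 - (inverse_coeff f 4)^2"

definition Omega2 :: "(real \<times> real) set" where
  "Omega2 = {(\<sigma>, \<mu>). 2 \<le> \<bar>\<sigma>\<bar> \<and> \<bar>\<sigma>\<bar> \<le> 4 \<and> \<mu> \<ge> (\<sigma>^2 + 8) / 12}"

definition Omega3 :: "(real \<times> real) set" where
  "Omega3 = {(\<sigma>, \<mu>). \<bar>\<sigma>\<bar> \<ge> 4 \<and> \<mu> \<ge> 2 / 3 * (\<bar>\<sigma>\<bar> - 1)}"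

lemma ma_minda_reflect:
  assumes "ma_minda \<phi>" "z \<in> ball 0 1"
  shows "cnj (\<phi> (cnj z)) = \<phi> z"
proof -
  let ?U = "ball 0 1 :: complex set"
  have hol: "\<phi> holomorphic_on ?U" and inj: "inj_on \<phi> ?U" and p0: "\<phi> 0 = 1"
    and im: "Im (deriv \<phi> 0) = 0" and re: "Re (deriv \<phi> 0) > 0" 
    and sym: "cnj ` (\<phi> ` ?U) = \<phi> ` ?U"
    using assms(1) by (auto simp: ma_minda_def)
  have cU: "cnj ` ?U = ?U"
  proof
    show "cnj ` ?U \<subseteq> ?U" by auto
    show "?U \<subseteq> cnj ` ?U" by (metis (no_types, opaque_lifting) complex_cnj_cnj complex_mod_cnj imageI mem_ball_0 subsetI)
  qed
  obtain h where hh: "h holomorphic_on (\<phi> ` ?U)"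
     and hd: "\<And>z. z \<in> ?U \<Longrightarrow> deriv \<phi> z * deriv h (\<phi> z) = 1"
     and hi: "\<And>z. z \<in> ?U \<Longrightarrow> h (\<phi> z) = z"
    using holomorphic_has_inverse[OF hol open_ball inj] by metis
  define \<psi> where "\<psi> = cnj \<circ> \<phi> \<circ> cnj"
  have psih: "\<psi> holomorphic_on ?U"
    unfolding \<psi>_def by (rule holomorphic_on_compose_cnj_cnj) (use hol cU in auto)
  have psim: "\<psi> z \<in> \<phi> ` ?U" if "z \<in> ?U" for z
  proof -
    have "cnj z \<in> ?U" using that by simp
    hence "cnj (\<phi> (cnj z)) \<in> cnj ` \<phi> ` ?U" by blast
    thus ?thesis using sym by (simp add: \<psi>_def)
  qed
  define k where "k = h \<circ> \<psi>"
  have kh: "k holomorphic_on ?U"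
    unfolding k_def by (rule holomorphic_on_compose_gen[OF psih hh]) (use psim in auto)
  have k0: "k 0 = 0"
    using hi[of 0] p0 by (simp add: k_def \<psi>_def)
  have kU: "norm (k z) < 1" if nz: "norm z < 1" for z
  proof -
    obtain u where "u \<in> ?U" "\<psi> z = \<phi> u" using psim[of z] nz by auto
    thus ?thesis using hi[of u] by (simp add: k_def)
  qed
  have op: "open (\<phi> ` ?U)"
    by (rule open_mapping_thm3[OF hol open_ball inj])
  have d1: "(\<phi> has_field_derivative deriv \<phi> 0) (at 0)"
    by (rule holomorphic_derivI[OF hol open_ball]) simp
  have dpsi: "(\<psi> has_field_derivative cnj (deriv \<phi> 0)) (at 0)"
    unfolding \<psi>_def using has_field_derivative_cnj_cnj[of \<phi> "deriv \<phi> 0" 0] d1 by (simp add: o_def)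
  have "(h has_field_derivative deriv h (\<psi> 0)) (at (\<psi> 0))"
    by (rule holomorphic_derivI[OF hh op]) (use psim[of 0] in auto)
  hence "(k has_field_derivative deriv h (\<psi> 0) * cnj (deriv \<phi> 0)) (at 0)"
    unfolding k_def using dpsi DERIV_chain by blast
  moreover have "cnj (deriv \<phi> 0) = deriv \<phi> 0" using im by (simp add: complex_eq_iff)
  moreover have "\<psi> 0 = \<phi> 0" using p0 by (simp add: \<psi>_def)
  ultimately have kd: "(k has_field_derivative 1) (at 0)"
    using hd[of 0] by (simp add: mult.commute)
  have dk: "deriv k 0 = 1" using kd by (rule DERIV_imp_deriv)
  obtain a where a: "\<And>z. norm z < 1 \<Longrightarrow> k z = a * z"
    using Schwarz_Lemma(3)[OF kh k0 kU, of 0] dk by auto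
  have "((\<lambda>z. a * z) has_field_derivative 1) (at 0)"
    by (rule has_field_derivative_transform_within_open[OF kd, of ?U]) (use a in auto)
  moreover have "((\<lambda>z. a * z) has_field_derivative a) (at 0)"
    by (auto intro!: derivative_eq_intros)
  ultimately have "a = 1" using DERIV_unique by blast
  hence kz: "k z = z" using a assms(2) by simp
  obtain u where "u \<in> ?U" "\<psi> z = \<phi> u" using psim[OF assms(2)] by auto
  hence "\<psi> z = \<phi> z" using hi[of u] kz by (simp add: k_def)
  thus ?thesis by (simp add: \<psi>_def)
qed

lemma ma_minda_coeff_real:
  assumes "ma_minda \<phi>"
  shows "taylor_coeff \<phi> n = of_real (mm_coeff \<phi> n)"
proof -
  let ?U = "ball 0 1 :: complex set"
  have hol: "\<phi> holomorphic_on ?U" using assms by (simp add: ma_minda_def)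
  have real: "(deriv ^^ n) \<phi> (cnj z) = cnj ((deriv ^^ n) \<phi> z)" if "z \<in> ?U" for z
    using that
  proof (induction n arbitrary: z)
    case 0
    thus ?case using ma_minda_reflect[OF assms, of z] by (metis complex_cnj_cnj funpow_0)
  next
    case (Suc n)
    let ?g = "(deriv ^^ n) \<phi>"
    have gh: "?g holomorphic_on ?U" by (rule holomorphic_higher_deriv[OF hol open_ball])
    have "(?g has_field_derivative deriv ?g z) (at z)"
      by (rule holomorphic_derivI[OF gh open_ball Suc.prems])
    hence "((cnj \<circ> ?g \<circ> cnj) has_field_derivative cnj (deriv ?g z)) (at (cnj z))"
      using has_field_derivative_cnj_cnj[of ?g "deriv ?g z" "cnj z"] by simp
    hence "(?g has_field_derivative cnj (deriv ?g z)) (at (cnj z))"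
      by (rule has_field_derivative_transform_within_open[of _ _ _ ?U])
         (use Suc in auto)
    thus ?case by (simp add: DERIV_imp_deriv)
  qed
  have "cnj ((deriv ^^ n) \<phi> 0) = (deriv ^^ n) \<phi> 0" using real[of 0] by simp
  hence "cnj (taylor_coeff \<phi> n) = taylor_coeff \<phi> n"
    by (simp add: taylor_coeff_def fps_expansion_def)
  thus ?thesis by (simp add: mm_coeff_def complex_eq_iff)
qed

end

theory Submission
  imports Defs
begin

text \<open>
  Write \<open>z f'(z) / f(z) = \<phi> (\<omega> z)\<close> with \<open>\<omega>(z) = c\<^sub>1 z + c\<^sub>2 z\<^sup>2 + c\<^sub>3 z\<^sup>3 + \<dots>\<close>. Comparing coefficients gives
  \<open>-2 b\<^sub>3 = B\<^sub>1 c\<^sub>2 + (B\<^sub>2 - 3 B\<^sub>1\<^sup>2) c\<^sub>1\<^sup>2\<close> and \<open>-3 b\<^sub>4 = B\<^sub>1 (c\<^sub>3 + \<sigma>\<^sub>3 c\<^sub>1 c\<^sub>2 + \<mu>\<^sub>3 c\<^sub>1\<^sup>3)\<close>.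
  The first is at most \<open>\<bar>B\<^sub>2 - 3 B\<^sub>1\<^sup>2\<bar>\<close> in modulus because \<open>\<bar>c\<^sub>2\<bar> \<le> 1 - \<bar>c\<^sub>1\<bar>\<^sup>2\<close>
  and \<open>B\<^sub>1 \<le> \<bar>B\<^sub>2 - 3 B\<^sub>1\<^sup>2\<bar>\<close>. For the second, the
  Prokhorov--Szynal bound \<open>\<bar>c\<^sub>3 + \<sigma> c\<^sub>1 c\<^sub>2 + \<mu> c\<^sub>1\<^sup>3\<bar> \<le> \<mu>\<close> on \<open>\<Omega>\<^sub>2 \<union> \<Omega>\<^sub>3\<close> is proved directly from the
  Schur parameters of \<open>\<omega>\<close>. Equality holds for \<open>\<omega>(z) = \<i> z\<close>, where \<open>b\<^sub>3\<close> is real and \<open>b\<^sub>4\<close> is purely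
  imaginary, so that \<open>b\<^sub>3\<^sup>2\<close> and \<open>-b\<^sub>4\<^sup>2\<close> add up.
\<close>

section \<open>Schur algorithm and the first coefficients of a Schwarz function\<close>

text \<open>The Moebius map taking \<open>g 0\<close> to 0 reduces this to the Schwarz lemma. The
  equation is multiplied out, with no division by \<open>1 - cnj (g 0) * g z\<close>, so that it
  also covers a unimodular constant \<open>g\<close>, where that factor vanishes.\<close>

lemma schur_step:
  assumes hol: "g holomorphic_on ball 0 1" and le: "\<And>z. z \<in> ball 0 1 \<Longrightarrow> cmod (g z) \<le> 1"
  obtains h where "h holomorphic_on ball 0 1" "\<And>z. z \<in> ball 0 1 \<Longrightarrow> cmod (h z) \<le> 1"
    "\<And>z. z \<in> ball 0 1 \<Longrightarrow> g z = g 0 + z * (h z * (1 - cnj (g 0) * g z))"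
proof (cases "\<exists>w\<in>ball 0 1. cmod (g w) = 1")
  case True
  then obtain w where w: "w \<in> ball 0 1" "cmod (g w) = 1" by blast
  have "g constant_on ball 0 1"
    by (rule maximum_modulus_principle[OF hol, of "ball 0 1" w]) (use w le in auto)
  then obtain c where c: "\<And>z. z \<in> ball 0 1 \<Longrightarrow> g z = c"
    by (auto simp: constant_on_def)
  show ?thesis
    by (rule that[of "\<lambda>_. 0"]) (use c in auto)
next
  case False
  then have lt: "cmod (g z) < 1" if "cmod z < 1" for z
    using that le[of z] by force
  define m where "m = Moebius_function 0 (g 0) \<circ> g"
  have g0: "cmod (g 0) < 1" using lt[of 0] by simp
  have mhol: "m holomorphic_on ball 0 1"
    unfolding m_def
    by (rule holomorphic_on_compose_gen[OF hol Moebius_function_holomorphic[OF g0]]) (use lt in auto)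
  have m0: "m 0 = 0" by (simp add: m_def Moebius_function_eq_zero)
  have mlt: "cmod (m z) < 1" if "cmod z < 1" for z
    unfolding m_def o_def by (rule Moebius_function_norm_lt_1[OF g0 lt[OF that]])
  obtain h where h: "h holomorphic_on ball 0 1" "\<And>z. cmod z < 1 \<Longrightarrow> m z = z * h z" "deriv m 0 = h 0"
    using Schwarz3[OF mhol m0] by blast
  show ?thesis
  proof (rule that[OF h(1)])
    fix z :: complex assume "z \<in> ball 0 1"
    then have z: "cmod z < 1" by simp
    show "cmod (h z) \<le> 1"
    \<comment> \<open>At 0 the factorization of \<open>m\<close> gives no bound on \<open>h\<close>;
      there \<open>h 0 = deriv m 0\<close>, and the derivative part of the Schwarz lemma
      applies.\<close>
    proof (cases "z = 0")
      case True
      then show ?thesis using Schwarz_Lemma(2)[OF mhol m0 mlt, of 0] h(3) by simp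
    next
      case False
      have "cmod (z * h z) \<le> cmod z"
        using Schwarz_Lemma(1)[OF mhol m0 mlt z] h(2)[OF z] by simp
      then show ?thesis using False by (simp add: norm_mult)
    qed
    have "cmod (cnj (g 0) * g z) < 1"
      using g0 lt[OF z] by (simp add: norm_mult) (metis mult_strict_mono' mult_1 norm_ge_zero)
    then have "1 - cnj (g 0) * g z \<noteq> 0" by auto
    then have "g z - g 0 = m z * (1 - cnj (g 0) * g z)"
      by (simp add: m_def Moebius_function_simple)
    then show "g z = g 0 + z * (h z * (1 - cnj (g 0) * g z))"
      using h(2)[OF z] by (simp add: algebra_simps)
  qed
qed

lemma has_fps_expansion_ball:
  "f holomorphic_on ball 0 1 \<Longrightarrow> f has_fps_expansion fps_expansion f 0"
  by (intro analytic_at_imp_has_fps_expansion_0)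
    (auto simp: analytic_on_open intro: analytic_on_subset[of f "ball 0 1"])

lemma eventually_in_unit_ball: "\<forall>\<^sub>F z in nhds (0::complex). z \<in> ball 0 1"
  by (rule eventually_nhds_in_open) auto

text \<open>The factor \<open>fps_X\<close> makes this a recursion: coefficient n + 1 of
  \<open>g\<close> on the left meets only coefficients up to n of \<open>g\<close> and
  \<open>h\<close> on the right.\<close>

lemma schur_step_fps:
  assumes hol: "g holomorphic_on ball 0 1" and le: "\<And>z. z \<in> ball 0 1 \<Longrightarrow> cmod (g z) \<le> 1"
  obtains h where "h holomorphic_on ball 0 1" "\<And>z. z \<in> ball 0 1 \<Longrightarrow> cmod (h z) \<le> 1"
    "fps_expansion g 0 = fps_const (g 0) + fps_X * (fps_expansion h 0 *
       (1 - fps_const (cnj (g 0)) * fps_expansion g 0))"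
proof -
  obtain h where h: "h holomorphic_on ball 0 1" "\<And>z. z \<in> ball 0 1 \<Longrightarrow> cmod (h z) \<le> 1"
    and eq: "\<And>z. z \<in> ball 0 1 \<Longrightarrow> g z = g 0 + z * (h z * (1 - cnj (g 0) * g z))"
    using schur_step[OF assms] by blast
  note [fps_expansion_intros] = has_fps_expansion_ball[OF hol] has_fps_expansion_ball[OF h(1)]
  have "(\<lambda>z. g 0 + z * (h z * (1 - cnj (g 0) * g z))) has_fps_expansion
      fps_const (g 0) + fps_X * (fps_expansion h 0 * (1 - fps_const (cnj (g 0)) * fps_expansion g 0))"
    by (intro fps_expansion_intros)
  moreover have "\<forall>\<^sub>F z in nhds 0. g 0 + z * (h z * (1 - cnj (g 0) * g z)) = g z"
    using eventually_in_unit_ball by eventually_elim (use eq in auto)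
  ultimately have "g has_fps_expansion
      fps_const (g 0) + fps_X * (fps_expansion h 0 * (1 - fps_const (cnj (g 0)) * fps_expansion g 0))"
    by (subst (asm) has_fps_expansion_cong) (rule refl | assumption)+
  from fps_expansion_eqI[OF this] h that show thesis by blast
qed

text \<open>Three Schur steps give functions \<open>g\<close>, \<open>h\<close>, \<open>k\<close>
  bounded by 1, whose values at 0 are the parameters. Coupled constraints on the coefficients thus
  become three separate disc bounds.\<close>

lemma schur_coeffs:
  assumes hol: "\<omega> holomorphic_on ball 0 1" and le: "\<And>z. z \<in> ball 0 1 \<Longrightarrow> cmod (\<omega> z) \<le> 1"
    and w0: "\<omega> 0 = 0"
  obtains a b d where "cmod a \<le> 1" "cmod b \<le> 1" "cmod d \<le> 1"
    "taylor_coeff \<omega> 1 = a" "taylor_coeff \<omega> 2 = of_real (1 - (cmod a)\<^sup>2) * b"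
    "taylor_coeff \<omega> 3 = of_real (1 - (cmod a)\<^sup>2) * (of_real (1 - (cmod b)\<^sup>2) * d - cnj a * b\<^sup>2)"
proof -
  \<comment> \<open>Since \<open>\<omega> 0 = 0\<close>, the first step is plain division by
    z.\<close>
  obtain g where g: "g holomorphic_on ball 0 1" "\<And>z. z \<in> ball 0 1 \<Longrightarrow> cmod (g z) \<le> 1"
    "fps_expansion \<omega> 0 = fps_X * fps_expansion g 0"
    using schur_step_fps[OF hol le] w0
    by (metis (no_types, lifting) add_0 complex_cnj_zero diff_zero fps_const_0_eq_0 mult_1_right mult_zero_left)
  obtain h where h: "h holomorphic_on ball 0 1" "\<And>z. z \<in> ball 0 1 \<Longrightarrow> cmod (h z) \<le> 1"
    and G: "fps_expansion g 0 = fps_const (g 0) + fps_X * (fps_expansion h 0 *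
       (1 - fps_const (cnj (g 0)) * fps_expansion g 0))"
    using schur_step_fps[OF g(1,2)] by blast
  obtain k where k: "k holomorphic_on ball 0 1" "\<And>z. z \<in> ball 0 1 \<Longrightarrow> cmod (k z) \<le> 1"
    and H: "fps_expansion h 0 = fps_const (h 0) + fps_X * (fps_expansion k 0 *
       (1 - fps_const (cnj (h 0)) * fps_expansion h 0))"
    using schur_step_fps[OF h] by blast
  have z: "fps_nth (fps_expansion f 0) 0 = f 0" for f :: "complex \<Rightarrow> complex"
    by (simp add: fps_expansion_def)
  have one: "of_real (1 - (cmod z)\<^sup>2) = 1 - cnj z * z" for z
    unfolding of_real_diff complex_norm_square by (simp add: mult.commute)
  have h1: "fps_nth (fps_expansion h 0) (Suc 0) = (1 - cnj (h 0) * h 0) * k 0"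
    by (subst H) (simp add: z fps_mult_nth)
  have g1: "fps_nth (fps_expansion g 0) (Suc 0) = (1 - cnj (g 0) * g 0) * h 0"
    by (subst G) (simp add: z fps_mult_nth)
  have g2: "fps_nth (fps_expansion g 0) 2
      = (1 - cnj (g 0) * g 0) * ((1 - cnj (h 0) * h 0) * k 0 - cnj (g 0) * (h 0)\<^sup>2)"
    by (subst G) (simp add: z fps_mult_nth numeral_2_eq_2 h1 g1, simp add: algebra_simps)
  show thesis
  proof (rule that[of "g 0" "h 0" "k 0"])
    show "taylor_coeff \<omega> 1 = g 0" "taylor_coeff \<omega> 2 = of_real (1 - (cmod (g 0))\<^sup>2) * h 0"
     "taylor_coeff \<omega> 3 = of_real (1 - (cmod (g 0))\<^sup>2) * (of_real (1 - (cmod (h 0))\<^sup>2) * k 0 - cnj (g 0) * (h 0)\<^sup>2)"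
      unfolding one using g1 g2 by (simp_all add: taylor_coeff_def g(3) z)
  qed (use g h k in auto)
qed

section \<open>Estimates for the cubic coefficient functional\<close>

text \<open>For fixed \<open>\<bar>\<beta>\<bar>\<close> the left-hand side is a concave quadratic in \<open>Re \<beta>\<close> (for \<open>m > 0\<close>); the right-hand
  side is its unconstrained maximum.\<close>

lemma cmod_quadratic_bound:
  fixes \<beta> :: complex and m s Y :: real
  assumes "Y \<ge> 0"
  shows "4 * m * (cmod (of_real m + of_real Y * (of_real s * \<beta> - \<beta>\<^sup>2)))\<^sup>2
      \<le> (m + Y * (cmod \<beta>)\<^sup>2)\<^sup>2 * (4 * m + s\<^sup>2 * Y)"
proof -
  obtain p q where b: "\<beta> = Complex p q" by (cases \<beta>)
  define t where "t = p\<^sup>2 + q\<^sup>2"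
  have t: "(cmod \<beta>)\<^sup>2 = t" by (simp add: b cmod_power2 t_def)
  have "(cmod (of_real m + of_real Y * (of_real s * \<beta> - \<beta>\<^sup>2)))\<^sup>2 =
        (m + Y * (s * p - p\<^sup>2 + q\<^sup>2))\<^sup>2 + (Y * (s * q - 2 * p * q))\<^sup>2"
    unfolding cmod_power2 by (simp add: b power2_eq_square algebra_simps)
  \<comment> \<open>With t = |\<beta>|^2 fixed, the gap is a completed square in p = Re \<beta>,
    vanishing at the vertex 4 m p = s (m - Y t).\<close>
  moreover have "(m + Y * t)\<^sup>2 * (4 * m + s\<^sup>2 * Y)
      - 4 * m * ((m + Y * (s * p - p\<^sup>2 + q\<^sup>2))\<^sup>2 + (Y * (s * q - 2 * p * q))\<^sup>2)
      = Y * (s * (m - Y * t) - 4 * m * p)\<^sup>2"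
    unfolding t_def by algebra
  ultimately have "(m + Y * (cmod \<beta>)\<^sup>2)\<^sup>2 * (4 * m + s\<^sup>2 * Y) -
      4 * m * (cmod (of_real m + of_real Y * (of_real s * \<beta> - \<beta>\<^sup>2)))\<^sup>2
      = Y * (s * (m - Y * t) - 4 * m * p)\<^sup>2"
    unfolding t by simp
  moreover have "Y * (s * (m - Y * t) - 4 * m * p)\<^sup>2 \<ge> 0" using assms by simp
  ultimately show ?thesis by linarith
qed

text \<open>The value \<open>\<mu> = (s\<^sup>2 + 8) / 12\<close> is exactly the one for which, with \<open>\<bar>b\<bar> = 1\<close>, the first-order
  terms in \<open>1 - \<bar>a\<bar>\<^sup>2\<close> cancel in the estimate below.\<close>

lemma cubic_bound_boundary:
  fixes a b :: complex and s \<mu> :: real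
  assumes a: "cmod a \<le> 1" and b: "cmod b \<le> 1" and s: "2 \<le> \<bar>s\<bar>" and mu: "\<mu> = (s\<^sup>2 + 8) / 12"
  shows "cmod (of_real \<mu> * a ^ 3 + of_real (1 - (cmod a)\<^sup>2) * (of_real s * a * b - cnj a * b\<^sup>2))
     + (1 - (cmod a)\<^sup>2) * (1 - (cmod b)\<^sup>2) \<le> \<mu>"
proof (cases "a = 0")
  case True
  have "s\<^sup>2 \<ge> 4" using s abs_le_square_iff[of 2 s] by simp
  then have "\<mu> \<ge> 1" by (simp add: mu)
  then show ?thesis using True by (simp add: order_trans[of _ 1])
next
  case False
  define x where "x = cmod a"
  \<comment> \<open>The terms a^3, a b and cnj a b^2 all have weight 3 under (a, b) \<mapsto> (u a,
    u^2 b). Dividing out the phase \<open>u\<close> of \<open>a\<close> leaves the positive number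
    \<open>x\<close> and one complex variable \<open>\<beta>\<close>.\<close>
  define u where "u = a / of_real x"
  define \<beta> where "\<beta> = b * (cnj u)\<^sup>2"
  define Y where "Y = 1 - x\<^sup>2"
  define t where "t = (cmod b)\<^sup>2"
  define N where "N = cmod (of_real (\<mu> * x\<^sup>2) + of_real Y * (of_real s * \<beta> - \<beta>\<^sup>2))"
  have x: "0 < x" "x \<le> 1" using a False by (auto simp: x_def)
  have Y: "0 \<le> Y" "Y \<le> 1" using x by (auto simp: Y_def power_le_one)
  have t: "0 \<le> t" "t \<le> 1" using b by (auto simp: t_def power_le_one)
  have u1: "cmod u = 1" using x by (simp add: u_def norm_divide x_def)
  then have uu: "u * cnj u = 1" by (simp add: complex_norm_square[symmetric])
  have au: "a = of_real x * u" using x by (simp add: u_def)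
  have bu: "b = u\<^sup>2 * \<beta>"
    using uu by (simp add: \<beta>_def power2_eq_square) (metis (no_types, lifting) mult.assoc mult.commute mult_1)
  have tb: "(cmod \<beta>)\<^sup>2 = t" by (simp add: \<beta>_def t_def norm_mult norm_power u1)
  have s4: "s\<^sup>2 \<ge> 4" using s abs_le_square_iff[of 2 s] by simp
  have mu1: "\<mu> \<ge> 1" using s4 by (simp add: mu)
  have "of_real \<mu> * a ^ 3 + of_real Y * (of_real s * a * b - cnj a * b\<^sup>2) =
     of_real x * u ^ 3 * (of_real (\<mu> * x\<^sup>2) + of_real Y * (of_real s * \<beta> - (u * cnj u) * \<beta>\<^sup>2))"
    unfolding bu by (subst (1 2 3) au) (simp add: power2_eq_square power3_eq_cube algebra_simps)
  then have norm_eq: "cmod (of_real \<mu> * a ^ 3 + of_real Y * (of_real s * a * b - cnj a * b\<^sup>2)) = x * N"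
    using x by (simp add: uu norm_mult norm_power u1 N_def)
  \<comment> \<open>Chosen so that 4 \<mu> x^2 + s^2 Y = 4 \<mu> (x^2 + k Y). That k \<ge> 1 amounts
    to s^2 \<ge> 4.\<close>
  define k where "k = s\<^sup>2 / (4 * \<mu>)"
  have k1: "k \<ge> 1" using mu1 s4 by (simp add: k_def field_simps mu)
  have kmu: "k * \<mu> = s\<^sup>2 / 4" using mu1 by (simp add: k_def)
  have "4 * (\<mu> * x\<^sup>2) * N\<^sup>2 \<le> (\<mu> * x\<^sup>2 + Y * t)\<^sup>2 * (4 * (\<mu> * x\<^sup>2) + s\<^sup>2 * Y)"
    using cmod_quadratic_bound[OF Y(1), of "\<mu> * x\<^sup>2" s \<beta>] unfolding tb N_def .
  also have "s\<^sup>2 = 4 * \<mu> * k" using kmu by (simp add: algebra_simps)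
  finally have "\<mu> * (x * N)\<^sup>2 \<le> \<mu> * ((\<mu> * x\<^sup>2 + Y * t)\<^sup>2 * (x\<^sup>2 + k * Y))"
    by (simp add: power_mult_distrib algebra_simps)
  then have "(x * N)\<^sup>2 \<le> (\<mu> * x\<^sup>2 + Y * t)\<^sup>2 * (x\<^sup>2 + k * Y)"
    by (rule mult_left_le_imp_le) (use mu1 in simp)
  also have "x\<^sup>2 + k * Y = 1 + (k - 1) * Y" by (simp add: Y_def algebra_simps)
  finally have sq: "(x * N)\<^sup>2 \<le> (\<mu> * x\<^sup>2 + Y * t)\<^sup>2 * (1 + (k - 1) * Y)" .
  \<comment> \<open>This is the tangent line bound sqrt (1 + y) \<le> 1 + y / 2 at y =
    \<open>(k - 1) * Y\<close>.\<close>
  define r where "r = 1 + (k - 1) * Y / 2"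
  have r1: "r \<ge> 1" using k1 Y by (simp add: r_def)
  have "1 + (k - 1) * Y \<le> r\<^sup>2"
  proof -
    have "r\<^sup>2 = 1 + (k - 1) * Y + ((k - 1) * Y / 2)\<^sup>2"
      by (simp add: r_def power2_eq_square algebra_simps)
    then show ?thesis by simp
  qed
  then have "(x * N)\<^sup>2 \<le> ((\<mu> * x\<^sup>2 + Y * t) * r)\<^sup>2"
    using sq by (smt (verit) mult_left_mono power_mult_distrib zero_le_power2)
  then have "x * N \<le> (\<mu> * x\<^sup>2 + Y * t) * r"
    by (rule power2_le_imp_le) (use mu1 r1 Y t in simp)
  then have "x * N + Y * (1 - t) \<le> (\<mu> * x\<^sup>2 + Y * t) * r + Y * (1 - t)" by simp
  \<comment> \<open>As r \<ge> 1, the expression is nondecreasing in t, so t = 1 is the worst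
    case.\<close>
  also have "\<dots> \<le> (\<mu> * x\<^sup>2 + Y) * r"
  proof -
    have "0 \<le> Y * (1 - t) * (r - 1)" using Y t r1 by simp
    then show ?thesis by (simp add: algebra_simps)
  qed
  also have "\<dots> \<le> \<mu>"
  proof -
    have "(\<mu> * x\<^sup>2 + Y) * r = \<mu> - (\<mu> - 1) * (k - 1) * Y\<^sup>2 / 2 + (k * \<mu> / 2 - 3 / 2 * \<mu> + 1) * Y"
      by (simp add: r_def Y_def power2_eq_square field_simps)
    also have "k * \<mu> / 2 - 3 / 2 * \<mu> + 1 = 0" unfolding kmu by (simp add: mu field_simps)
    finally show ?thesis using mu1 k1 by simp
  qed
  finally show ?thesis using norm_eq by (simp add: Y_def t_def x_def)
qed

text \<open>The pairs \<open>(s, \<mu>)\<close> satisfying the bound form a convex set. \<open>\<Omega>\<^sub>2\<close> lies above the boundary curve of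
  the previous lemma, and \<open>\<Omega>\<^sub>3\<close> is reached from its end points \<open>(\<plusminus>4, 2)\<close> along the directions
  \<open>(\<plusminus>1, 2/3)\<close> and \<open>(0, 1)\<close>.\<close>

lemma cubic_bound:
  fixes a b :: complex and s \<mu> :: real
  assumes a: "cmod a \<le> 1" and b: "cmod b \<le> 1" and smu: "(s, \<mu>) \<in> Omega2 \<union> Omega3"
  shows "cmod (of_real \<mu> * a ^ 3 + of_real (1 - (cmod a)\<^sup>2) * (of_real s * a * b - cnj a * b\<^sup>2))
     + (1 - (cmod a)\<^sup>2) * (1 - (cmod b)\<^sup>2) \<le> \<mu>"
proof -
  define Y where "Y = 1 - (cmod a)\<^sup>2"
  \<comment> \<open>\<open>E\<close> is affine in (s, \<mu>), which lets the bound be carried along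
    rays by the triangle inequality.\<close>
  define E where "E s \<mu> = of_real \<mu> * a ^ 3 + of_real Y * (of_real s * a * b - cnj a * b\<^sup>2)"
    for s \<mu> :: real
  define x where "x = cmod a"
  have x: "0 \<le> x" "x \<le> 1" using a by (auto simp: x_def)
  have Y: "Y = 1 - x\<^sup>2" "0 \<le> Y" using x by (auto simp: Y_def x_def power_le_one)
  have bd: "cmod (E s ((s\<^sup>2 + 8) / 12)) + Y * (1 - (cmod b)\<^sup>2) \<le> (s\<^sup>2 + 8) / 12" if "2 \<le> \<bar>s\<bar>" for s
    using cubic_bound_boundary[OF a b that refl] by (simp add: E_def Y_def)
  \<comment> \<open>Raising \<mu> by \<delta> raises the norm by at most \<delta> |a|^3 \<le>
    \<delta>.\<close>
  have up: "cmod (E s \<mu>) + Y * (1 - (cmod b)\<^sup>2) \<le> \<mu>"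
    if "cmod (E s \<mu>0) + Y * (1 - (cmod b)\<^sup>2) \<le> \<mu>0" "\<mu>0 \<le> \<mu>" for s \<mu> \<mu>0
  proof -
    have "E s \<mu> = E s \<mu>0 + of_real (\<mu> - \<mu>0) * a ^ 3" by (simp add: E_def algebra_simps)
    then have "cmod (E s \<mu>) \<le> cmod (E s \<mu>0) + (\<mu> - \<mu>0) * x ^ 3"
      using that(2) norm_triangle_ineq[of "E s \<mu>0" "of_real (\<mu> - \<mu>0) * a ^ 3"]
      by (simp add: norm_mult norm_power x_def del: of_real_diff)
    moreover have "(\<mu> - \<mu>0) * x ^ 3 \<le> \<mu> - \<mu>0"
      using that(2) x by (simp add: mult_left_le power_le_one)
    ultimately show ?thesis using that by linarith
  qed
  have "cmod (E s \<mu>) + Y * (1 - (cmod b)\<^sup>2) \<le> \<mu>"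
  proof (cases "\<bar>s\<bar> \<le> 4")
    case True
    then have "2 \<le> \<bar>s\<bar>" "(s\<^sup>2 + 8) / 12 \<le> \<mu>"
    proof -
      \<comment> \<open>At |s| = 4 both regions start at \<mu> = 2, so membership in either
        suffices.\<close>
      have "s\<^sup>2 = 16" if "\<bar>s\<bar> = 4" using that power2_abs[of s] by simp
      then show "2 \<le> \<bar>s\<bar>" "(s\<^sup>2 + 8) / 12 \<le> \<mu>" 
        using smu True by (auto simp: Omega2_def Omega3_def)
    qed
    then show ?thesis using up[OF bd] by blast
  next
    case False
    define d where "d = \<bar>s\<bar> - 4"
    have d: "d \<ge> 0" using False by (simp add: d_def)
    have s: "s = 4 * sgn s + d * sgn s" by (simp add: d_def algebra_simps sgn_if)
    have sg: "\<bar>sgn s\<bar> = 1" using False by (auto simp: abs_sgn_eq)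
    have mu: "2 + 2 / 3 * d \<le> \<mu>" 
    proof -
      have "2 / 3 * (\<bar>s\<bar> - 1) \<le> \<mu>" using smu False by (auto simp: Omega2_def Omega3_def)
      then show ?thesis by (simp add: d_def field_simps)
    qed
    \<comment> \<open>\<open>D\<close> is the increment of \<open>E\<close> per unit step along the
      edge of \<open>Omega3\<close>, in the direction (sgn s, 2/3).\<close>
    define D where "D = of_real (2 / 3) * a ^ 3 + of_real (Y * sgn s) * a * b"
    have "cmod D \<le> 2 / 3 * x ^ 3 + Y * x * cmod b"
      unfolding D_def using norm_triangle_ineq[of "of_real (2 / 3) * a ^ 3" "of_real (Y * sgn s) * a * b"] sg Y(2)
      by (simp add: norm_mult norm_power x_def abs_mult)
    also have "Y * x * cmod b \<le> Y * x" using x Y b by (simp add: mult_left_le)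
    \<comment> \<open>The left side is x - x^3 / 3, which increases to 2/3 on [0, 1]; the gap has a
      double zero at x = 1.\<close>
    also have "2 / 3 * x ^ 3 + Y * x = 2 / 3 - (1 - x)\<^sup>2 * (2 + x) / 3"
      by (simp add: Y power2_eq_square power3_eq_cube field_simps)
    also have "\<dots> \<le> 2 / 3" using x by simp
    finally have D: "cmod D \<le> 2 / 3" by simp
    have "E s (2 + 2 / 3 * d) = E (4 * sgn s) 2 + of_real d * D"
      by (subst s) (simp add: E_def D_def algebra_simps)
    then have "cmod (E s (2 + 2 / 3 * d)) \<le> cmod (E (4 * sgn s) 2) + d * cmod D"
      using d norm_triangle_ineq[of "E (4 * sgn s) 2" "of_real d * D"] by (simp add: norm_mult)
    moreover have "d * cmod D \<le> d * (2 / 3)" using D d by (intro mult_left_mono) auto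
    moreover have "cmod (E (4 * sgn s) 2) + Y * (1 - (cmod b)\<^sup>2) \<le> 2"
    proof -
      have "sgn s = 1 \<or> sgn s = - 1" using sg by linarith
      then have "(4 * sgn s)\<^sup>2 = 16" by auto
      then show ?thesis using bd[of "4 * sgn s"] sg by (simp add: abs_mult)
    qed
    ultimately show ?thesis using up[OF _ mu] by auto
  qed
  then show ?thesis by (simp add: E_def Y_def)
qed

section \<open>Local inverse and its coefficients\<close>

text \<open>This makes the \<open>SOME\<close> in \<open>inverse_coeff\<close> denote an actual
  local inverse. As f'(0) = 1, \<open>f\<close> is injective with open image on a small
  disc.\<close>

lemma local_inverse_exists:
  assumes "f \<in> class_A"
  shows "\<exists>g. is_local_inverse f g"
proof -
  have hol: "f holomorphic_on ball 0 1" and f0: "f 0 = 0" and f1: "deriv f 0 = 1"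
    using assms by (auto simp: class_A_def)
  have nz: "deriv f 0 \<noteq> 0" using f1 by simp
  obtain r where r: "r > 0" "ball (0::complex) r \<subseteq> ball 0 1" "open (f ` ball 0 r)" "inj_on f (ball 0 r)"
    by (rule has_complex_derivative_locally_invertible[OF hol _ open_ball nz]) (simp, blast)
  obtain g where g: "g holomorphic_on f ` ball 0 r" "\<And>z. z \<in> ball 0 r \<Longrightarrow> g (f z) = z"
    using holomorphic_has_inverse[OF holomorphic_on_subset[OF hol r(2)] open_ball r(4)] by metis
  have in0: "0 \<in> f ` ball 0 r" using r(1) f0 by force
  have "g analytic_on {0}"
    using g(1) r(3) in0 analytic_at by blast
  moreover have "g 0 = 0" using g(2)[of 0] r(1) f0 by simp
  moreover have "\<forall>\<^sub>F w in nhds 0. w \<in> f ` ball 0 r"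
    by (rule eventually_nhds_in_open[OF r(3) in0])
  then have "\<forall>\<^sub>F w in nhds 0. f (g w) = w"
    by eventually_elim (use g(2) in auto)
  moreover have "\<forall>\<^sub>F z in nhds 0. z \<in> ball 0 r"
    by (rule eventually_nhds_in_open) (use r(1) in auto)
  then have "\<forall>\<^sub>F z in nhds 0. g (f z) = z"
    by eventually_elim (use g(2) in auto)
  ultimately show ?thesis unfolding is_local_inverse_def by blast
qed

text \<open>As \<open>G\<close> has no constant term, its nth coefficient enters coefficient n of
  the composition only through the term with factor \<open>fps_nth F 1 = 1\<close>, so the
  coefficients are solved for one after another.\<close>

lemma fps_compose_inverse_coeffs:
  fixes F G :: "complex fps"
  assumes FG: "fps_compose F G = fps_X" and F1: "fps_nth F 1 = 1" and G0: "fps_nth G 0 = 0"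
  shows "fps_nth G 3 = 2 * (fps_nth F 2)\<^sup>2 - fps_nth F 3"
    and "fps_nth G 4 = - 5 * (fps_nth F 2) ^ 3 + 5 * fps_nth F 2 * fps_nth F 3 - fps_nth F 4"
proof -
  have c: "(\<Sum>i=0..n. fps_nth F i * fps_nth (G ^ i) n) = fps_nth fps_X n" for n
    using FG by (metis fps_compose_nth)
  note sm = eval_nat_numeral fps_mult_nth G0 F1[unfolded One_nat_def]
  have g1: "fps_nth G (Suc 0) = 1" using c[of "Suc 0"] by (simp add: sm)
  have g2: "fps_nth G (Suc (Suc 0)) = - fps_nth F (Suc (Suc 0))"
    using c[of 2] by (simp add: sm g1 eq_neg_iff_add_eq_0)
  have g3: "fps_nth G (Suc (Suc (Suc 0))) = 2 * (fps_nth F (Suc (Suc 0)))\<^sup>2 - fps_nth F (Suc (Suc (Suc 0)))"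
    using c[of 3] by (simp add: sm g1 g2) algebra
  have g4: "fps_nth G (Suc (Suc (Suc (Suc 0)))) = - 5 * (fps_nth F (Suc (Suc 0))) ^ 3
      + 5 * fps_nth F (Suc (Suc 0)) * fps_nth F (Suc (Suc (Suc 0))) - fps_nth F (Suc (Suc (Suc (Suc 0))))"
    using c[of 4] by (simp add: sm g1 g2 g3) algebra
  show "fps_nth G 3 = 2 * (fps_nth F 2)\<^sup>2 - fps_nth F 3"
    and "fps_nth G 4 = - 5 * (fps_nth F 2) ^ 3 + 5 * fps_nth F 2 * fps_nth F 3 - fps_nth F 4"
    using g3 g4 by (simp_all add: eval_nat_numeral)
qed

lemma inverse_coeff_eq:
  assumes "f \<in> class_A"
  shows "inverse_coeff f 3 = 2 * (taylor_coeff f 2)\<^sup>2 - taylor_coeff f 3"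
    and "inverse_coeff f 4 = - 5 * (taylor_coeff f 2) ^ 3
           + 5 * taylor_coeff f 2 * taylor_coeff f 3 - taylor_coeff f 4"
proof -
  define g where "g = (SOME g. is_local_inverse f g)"
  have g: "is_local_inverse f g"
    unfolding g_def using local_inverse_exists[OF assms] by (rule someI_ex)
  have F: "f has_fps_expansion fps_expansion f 0"
    using assms by (auto simp: class_A_def intro: has_fps_expansion_ball)
  have G: "g has_fps_expansion fps_expansion g 0"
    using g by (auto simp: is_local_inverse_def intro: analytic_at_imp_has_fps_expansion_0)
  have G0: "fps_nth (fps_expansion g 0) 0 = 0"
    using g by (simp add: is_local_inverse_def fps_expansion_def)
  have F1: "fps_nth (fps_expansion f 0) 1 = 1"
    using assms by (simp add: class_A_def fps_expansion_def)
  have "(\<lambda>w. w) has_fps_expansion fps_compose (fps_expansion f 0) (fps_expansion g 0)"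
  proof -
    have "(f \<circ> g) has_fps_expansion fps_compose (fps_expansion f 0) (fps_expansion g 0)"
      by (rule has_fps_expansion_compose[OF F G G0])
    moreover have "\<forall>\<^sub>F w in nhds 0. (f \<circ> g) w = w"
      using g by (simp add: is_local_inverse_def)
    ultimately show ?thesis
      by (subst (asm) has_fps_expansion_cong) (rule refl | assumption)+
  qed
  then have FG: "fps_compose (fps_expansion f 0) (fps_expansion g 0) = fps_X"
    using fps_expansion_unique_complex has_fps_expansion_fps_X by blast
  show "inverse_coeff f 3 = 2 * (taylor_coeff f 2)\<^sup>2 - taylor_coeff f 3"
    and "inverse_coeff f 4 = - 5 * (taylor_coeff f 2) ^ 3
           + 5 * taylor_coeff f 2 * taylor_coeff f 3 - taylor_coeff f 4"
    using fps_compose_inverse_coeffs[OF FG F1 G0]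
    unfolding inverse_coeff_def taylor_coeff_def g_def by auto
qed

section \<open>Coefficient relations for the starlike class\<close>

text \<open>Clearing the denominator in \<open>starlike_quotient\<close> avoids dividing by the
  series of \<open>f\<close>, which has no constant term.\<close>

lemma starlike_fps_eq:
  assumes phi: "ma_minda \<phi>" and f: "f \<in> class_A"
    and w: "\<omega> holomorphic_on ball 0 1" "\<omega> 0 = 0"
    and eq: "\<And>z. z \<in> ball 0 1 \<Longrightarrow> starlike_quotient f z = \<phi> (\<omega> z)"
  shows "fps_X * fps_deriv (fps_expansion f 0)
         = fps_expansion f 0 * fps_compose (fps_expansion \<phi> 0) (fps_expansion \<omega> 0)"
proof -
  have phol: "\<phi> holomorphic_on ball 0 1" and pre: "\<And>z. z \<in> ball 0 1 \<Longrightarrow> Re (\<phi> z) > 0"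
    using phi unfolding ma_minda_def by blast+
  have fhol: "f holomorphic_on ball 0 1" and f0: "f 0 = 0"
    using f by (auto simp: class_A_def)
  note ex = has_fps_expansion_ball[OF phol] has_fps_expansion_ball[OF fhol] has_fps_expansion_ball[OF w(1)]
  have "isCont \<omega> 0"
    using w(1)
    by (meson centre_in_ball continuous_on_eq_continuous_at holomorphic_on_imp_continuous_on open_ball zero_less_one)
  then have "(\<omega> \<longlongrightarrow> 0) (nhds 0)"
    using tendsto_at_iff_tendsto_nhds[of \<omega> 0] w(2) by (simp add: isCont_def)
  then have "\<forall>\<^sub>F z in nhds 0. \<omega> z \<in> ball 0 1"
    by (rule topological_tendstoD) auto
  with eventually_in_unit_ball
  have "\<forall>\<^sub>F z in nhds 0. z * deriv f z = f z * (\<phi> \<circ> \<omega>) z"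
  proof eventually_elim
    case (elim z)
    have ne: "\<phi> (\<omega> z) \<noteq> 0" using pre[OF elim(2)] by auto
    show ?case
    proof (cases "z = 0")
      case False
      then have "z * deriv f z / f z = \<phi> (\<omega> z)"
        using eq[OF elim(1)] by (simp add: starlike_quotient_def)
      \<comment> \<open>A zero of \<open>f\<close> here would make the quotient 0 by x / 0 = 0,
        against \<open>\<phi> (\<omega> z) \<noteq> 0\<close>.\<close>
      with ne show ?thesis by (cases "f z = 0") (auto simp: field_simps)
    qed (simp add: f0)
  qed
  moreover have "(\<lambda>z. z * deriv f z) has_fps_expansion fps_X * fps_deriv (fps_expansion f 0)"
    using ex by (intro fps_expansion_intros)
  ultimately have "(\<lambda>z. f z * (\<phi> \<circ> \<omega>) z) has_fps_expansion fps_X * fps_deriv (fps_expansion f 0)"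
    by (subst (asm) has_fps_expansion_cong) (rule refl | assumption)+
  moreover have "(\<lambda>z. f z * (\<phi> \<circ> \<omega>) z) has_fps_expansion
      fps_expansion f 0 * fps_compose (fps_expansion \<phi> 0) (fps_expansion \<omega> 0)"
    using ex w(2) by (intro has_fps_expansion_mult has_fps_expansion_compose) (auto simp: fps_expansion_def)
  ultimately show ?thesis by (rule fps_expansion_unique_complex)
qed

text \<open>With P = \<phi> \<circ> \<omega> the series equation reads (n - 1) a_n = sum of a_k
  P_(n-k) over 1 \<le> k < n. It determines a_2, a_3, a_4 in turn, and these are put into
  \<open>inverse_coeff_eq\<close>.\<close>

lemma inverse_coeff_starlike:
  fixes \<phi> :: "complex \<Rightarrow> complex"
  assumes phi: "ma_minda \<phi>" and f: "f \<in> class_A"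
    and w: "\<omega> holomorphic_on ball 0 1" "\<omega> 0 = 0"
    and eq: "\<And>z. z \<in> ball 0 1 \<Longrightarrow> starlike_quotient f z = \<phi> (\<omega> z)"
  defines "p \<equiv> taylor_coeff \<phi>" and "c \<equiv> taylor_coeff \<omega>"
  shows "inverse_coeff f 3 = - (p 1 * c 2 + (p 2 - 3 * (p 1)\<^sup>2) * (c 1)\<^sup>2) / 2"
    and "inverse_coeff f 4 = - (p 1 * c 3 + 2 * (p 2 - 3 * (p 1)\<^sup>2) * c 1 * c 2
           + (8 * p 1 ^ 3 - 6 * p 1 * p 2 + p 3) * c 1 ^ 3) / 3"
proof -
  define F \<Phi> W where "F = fps_expansion f 0" and "\<Phi> = fps_expansion \<phi> 0" and "W = fps_expansion \<omega> 0"
  have F0: "fps_nth F 0 = 0" and F1: "fps_nth F (Suc 0) = 1"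
    using f by (auto simp: F_def fps_expansion_def class_A_def)
  have P0: "fps_nth \<Phi> 0 = 1" and W0: "fps_nth W 0 = 0"
    using phi w(2) by (auto simp: \<Phi>_def W_def fps_expansion_def ma_minda_def)
  define P where "P = fps_compose \<Phi> W"
  note sm = eval_nat_numeral fps_mult_nth F0 F1 P0 W0
  have Q0: "fps_nth P 0 = 1" by (simp add: P_def P0)
  have Q1: "fps_nth P (Suc 0) = p 1 * c 1"
    and Q2: "fps_nth P (Suc (Suc 0)) = p 1 * c 2 + p 2 * (c 1)\<^sup>2"
    and Q3: "fps_nth P (Suc (Suc (Suc 0))) = p 1 * c 3 + 2 * p 2 * c 1 * c 2 + p 3 * c 1 ^ 3"
    by (simp_all add: P_def fps_compose_nth sm p_def c_def taylor_coeff_def flip: \<Phi>_def W_def)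
  have ode: "fps_nth (fps_X * fps_deriv F) n = fps_nth (F * P) n" for n
    using starlike_fps_eq[OF assms(1-5)] by (simp add: F_def P_def \<Phi>_def W_def)
  have F2: "taylor_coeff f 2 = p 1 * c 1"
    using ode[of 2] by (simp add: sm Q0 Q1 Q2 Q3 taylor_coeff_def flip: F_def)
  have F3: "2 * taylor_coeff f 3 = p 1 * c 2 + p 2 * (c 1)\<^sup>2 + (p 1 * c 1)\<^sup>2"
    using ode[of 3] F2 by (simp add: sm Q0 Q1 Q2 Q3 taylor_coeff_def flip: F_def)
  have F4: "3 * taylor_coeff f 4 = p 1 * c 3 + 2 * p 2 * c 1 * c 2 + p 3 * c 1 ^ 3
      + (p 1 * c 1) * (p 1 * c 2 + p 2 * (c 1)\<^sup>2) + taylor_coeff f 3 * (p 1 * c 1)"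
    using ode[of 4] F2 by (simp add: sm Q0 Q1 Q2 Q3 taylor_coeff_def flip: F_def)
  show "inverse_coeff f 3 = - (p 1 * c 2 + (p 2 - 3 * (p 1)\<^sup>2) * (c 1)\<^sup>2) / 2"
    unfolding inverse_coeff_eq[OF f] F2 using F3 by (simp add: field_simps)
  show "inverse_coeff f 4 = - (p 1 * c 3 + 2 * (p 2 - 3 * (p 1)\<^sup>2) * c 1 * c 2
           + (8 * p 1 ^ 3 - 6 * p 1 * p 2 + p 3) * c 1 ^ 3) / 3"
    unfolding inverse_coeff_eq[OF f] F2 using F3 F4 by (simp add: field_simps) algebra
qed

section \<open>Rotated extremal functions\<close>

lemma holomorphic_on_rotation:
  assumes hol: "f holomorphic_on ball 0 r" and u: "cmod u = 1"
  shows "(\<lambda>z. f (u * z)) holomorphic_on ball 0 r"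
proof -
  have "(*) u holomorphic_on ball 0 r" by (intro holomorphic_intros)
  moreover have "(*) u ` ball 0 r \<subseteq> ball 0 r" using u by (auto simp: norm_mult)
  ultimately have "f \<circ> (*) u holomorphic_on ball 0 r"
    by (rule holomorphic_on_compose_gen[OF _ hol])
  then show ?thesis by (simp add: o_def)
qed

text \<open>Integrating the logarithmic derivative gives f(z) = z exp (Q(z) - Q(0)) with Q'(z) =
  (\<phi>(u z) - 1) / z.\<close>

lemma starlike_extremal_exists:
  assumes hol: "\<phi> holomorphic_on ball 0 1" and p0: "\<phi> 0 = 1" and u: "cmod u = 1"
  obtains f where "f \<in> class_A" "\<And>z. z \<in> ball 0 1 \<Longrightarrow> starlike_quotient f z = \<phi> (u * z)"
proof -
  have comp: "(\<lambda>z. \<phi> (u * z)) holomorphic_on ball 0 1"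
    by (rule holomorphic_on_rotation[OF hol u])
  have "(\<lambda>z. \<phi> (u * z) - 1) holomorphic_on ball 0 1"
    by (intro holomorphic_intros comp)
  \<comment> \<open>\<open>q\<close> is this quotient with its removable singularity at 0 filled
    in.\<close>
  then obtain q where q: "q holomorphic_on ball 0 1" "\<And>z. cmod z < 1 \<Longrightarrow> \<phi> (u * z) - 1 = z * q z"
    using Schwarz3[of "\<lambda>z. \<phi> (u * z) - 1" 1] p0 by auto
  obtain Q where Q: "\<And>z. z \<in> ball 0 1 \<Longrightarrow> (Q has_field_derivative q z) (at z within ball 0 1)"
    using holomorphic_convex_primitive'[OF convex_ball open_ball q(1)] by blast
  \<comment> \<open>Subtracting \<open>Q 0\<close> normalizes f'(0) to 1; since exp has no zeros,
    \<open>f\<close> vanishes only at 0.\<close>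
  define f where "f z = z * exp (Q z - Q 0)" for z
  have d: "(f has_field_derivative exp (Q z - Q 0) * \<phi> (u * z)) (at z)" if "z \<in> ball 0 1" for z
  proof -
    have "(Q has_field_derivative q z) (at z)" using Q[OF that] at_within_open[OF that] by simp
    then have "(f has_field_derivative exp (Q z - Q 0) + z * (exp (Q z - Q 0) * q z)) (at z)"
      unfolding f_def[abs_def] by (auto intro!: derivative_eq_intros)
    moreover have "\<phi> (u * z) = 1 + z * q z" using q(2)[of z] that by (simp add: algebra_simps)
    ultimately show ?thesis by (simp add: algebra_simps)
  qed
  show thesis
  proof (rule that[of f])
    have "f holomorphic_on ball 0 1" using d holomorphic_on_open by blast
    then show "f \<in> class_A"
      using DERIV_imp_deriv[OF d[of 0]] p0 by (simp add: class_A_def f_def)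
    show "starlike_quotient f z = \<phi> (u * z)" if "z \<in> ball 0 1" for z
      using DERIV_imp_deriv[OF d[OF that]] p0 by (simp add: starlike_quotient_def f_def)
  qed
qed

lemma starlike_quotient_subordinate:
  assumes hol: "\<phi> holomorphic_on ball 0 1" and u: "cmod u = 1"
    and eq: "\<And>z. z \<in> ball 0 1 \<Longrightarrow> starlike_quotient f z = \<phi> (u * z)"
  shows "starlike_quotient f \<prec>\<^sub>U \<phi>"
proof -
  have "(\<lambda>z. \<phi> (u * z)) holomorphic_on ball 0 1"
    by (rule holomorphic_on_rotation[OF hol u])
  then have "starlike_quotient f holomorphic_on ball 0 1"
    by (rule holomorphic_transform) (use eq in auto)
  moreover have "(\<lambda>z. u * z) holomorphic_on ball 0 1" by (intro holomorphic_intros)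
  ultimately show ?thesis
    unfolding subordinate_def using hol eq u
    by (intro conjI exI[of _ "\<lambda>z. u * z"]) (auto simp: norm_mult)
qed

section \<open>Sharp bound for \<open>T22_inverse\<close>\<close>

theorem theorem8:
  fixes \<phi> :: "complex \<Rightarrow> complex" and B :: "nat \<Rightarrow> real" and \<sigma>3 \<mu>3 :: real
  assumes "ma_minda \<phi>"
    and "B = mm_coeff \<phi>"
    and "\<sigma>3 = 2 * (B 2 - 3 * (B 1)^2) / B 1"
    and "\<mu>3 = (8 * (B 1)^3 - 6 * B 1 * B 2 + B 3) / B 1"
    and "(\<sigma>3, \<mu>3) \<in> Omega2 \<union> Omega3"
    and "B 1 \<le> \<bar>3 * (B 1)^2 - B 2\<bar>"
  shows "(\<forall>f \<in> starlike_class \<phi>. cmod (T22_inverse f) \<le>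
            (B 2 - 3 * (B 1)^2)^2 / 4 + (8 * (B 1)^3 - 6 * B 1 * B 2 + B 3)^2 / 9) \<and>
         (\<exists>f \<in> starlike_class \<phi>. cmod (T22_inverse f) =
            (B 2 - 3 * (B 1)^2)^2 / 4 + (8 * (B 1)^3 - 6 * B 1 * B 2 + B 3)^2 / 9)"
proof -
  have hol: "\<phi> holomorphic_on ball 0 1" and p0: "\<phi> 0 = 1" and p1: "Re (deriv \<phi> 0) > 0"
    using assms(1) by (auto simp: ma_minda_def)
  have tc: "taylor_coeff \<phi> n = of_real (B n)" for n
    using ma_minda_coeff_real[OF assms(1)] assms(2) by simp
  have B1: "B 1 > 0"
    using p1 by (simp add: assms(2) mm_coeff_def taylor_coeff_def fps_expansion_def)
  define K where "K = B 2 - 3 * (B 1)\<^sup>2"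
  define L where "L = 8 * (B 1)^3 - 6 * B 1 * B 2 + B 3"
  have sig: "B 1 * \<sigma>3 = 2 * K" and mu: "B 1 * \<mu>3 = L"
    using B1 by (simp_all add: assms(3,4) K_def L_def)
  have K: "B 1 \<le> \<bar>K\<bar>" using assms(6) by (simp add: K_def)
  have coeffs: "inverse_coeff f 3 = - (of_real (B 1) * taylor_coeff \<omega> 2 + of_real K * (taylor_coeff \<omega> 1)\<^sup>2) / 2"
    "inverse_coeff f 4 = - (of_real (B 1) * taylor_coeff \<omega> 3
       + 2 * of_real K * taylor_coeff \<omega> 1 * taylor_coeff \<omega> 2 + of_real L * taylor_coeff \<omega> 1 ^ 3) / 3"
    if "f \<in> class_A" "\<omega> holomorphic_on ball 0 1" "\<omega> 0 = 0"
      "\<And>z. z \<in> ball 0 1 \<Longrightarrow> starlike_quotient f z = \<phi> (\<omega> z)" for f \<omega>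
    using inverse_coeff_starlike[OF assms(1) that] by (simp_all add: tc K_def L_def)
  have "cmod (T22_inverse f) \<le> K\<^sup>2 / 4 + L\<^sup>2 / 9" if f: "f \<in> starlike_class \<phi>" for f
  proof -
    have fA: "f \<in> class_A" using f by (simp add: starlike_class_def)
    obtain \<omega> where w: "\<omega> holomorphic_on ball 0 1" "\<omega> 0 = 0"
      and le: "\<And>z. z \<in> ball 0 1 \<Longrightarrow> cmod (\<omega> z) \<le> 1"
      and eq: "\<And>z. z \<in> ball 0 1 \<Longrightarrow> starlike_quotient f z = \<phi> (\<omega> z)"
      using f unfolding starlike_class_def subordinate_def by blast
    obtain a b d where abd: "cmod a \<le> 1" "cmod b \<le> 1" "cmod d \<le> 1"
      and c: "taylor_coeff \<omega> 1 = a" "taylor_coeff \<omega> 2 = of_real (1 - (cmod a)\<^sup>2) * b"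
        "taylor_coeff \<omega> 3 = of_real (1 - (cmod a)\<^sup>2) * (of_real (1 - (cmod b)\<^sup>2) * d - cnj a * b\<^sup>2)"
      using schur_coeffs[OF w(1) le w(2)] by metis
    define Y where "Y = 1 - (cmod a)\<^sup>2"
    define Z where "Z = 1 - (cmod b)\<^sup>2"
    have YZ: "0 \<le> Y" "0 \<le> Z" using abd by (auto simp: Y_def Z_def power_le_one)
    have b3: "inverse_coeff f 3 = - (of_real (B 1) * (of_real Y * b) + of_real K * a\<^sup>2) / 2"
      using coeffs(1)[OF fA w eq] unfolding c Y_def .
    have b4: "inverse_coeff f 4 = - (of_real (B 1) * (of_real Y * (of_real Z * d - cnj a * b\<^sup>2))
       + 2 * of_real K * a * (of_real Y * b) + of_real L * a ^ 3) / 3"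
      using coeffs(2)[OF fA w eq] unfolding c Y_def Z_def .
    have "cmod (of_real (B 1) * (of_real Y * b) + of_real K * a\<^sup>2) \<le> B 1 * (Y * cmod b) + \<bar>K\<bar> * (cmod a)\<^sup>2"
      using norm_triangle_ineq[of "of_real (B 1) * (of_real Y * b)" "of_real K * a\<^sup>2"] B1 YZ
      by (simp add: norm_mult norm_power)
    \<comment> \<open>B 1 \<le> |K| and |b| \<le> 1 leave |K| with the weights \<open>Y\<close> and
      |a|^2, which sum to 1.\<close>
    also have "\<dots> \<le> \<bar>K\<bar> * (Y * 1) + \<bar>K\<bar> * (cmod a)\<^sup>2"
      using K B1 YZ abd by (intro add_right_mono mult_mono) auto
    also have "\<dots> = \<bar>K\<bar>" by (simp add: Y_def algebra_simps)
    finally have "cmod (inverse_coeff f 3) \<le> \<bar>K\<bar> / 2"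
      unfolding b3 by (simp add: norm_divide norm_minus_commute norm_uminus_minus del: minus_add_distrib)
    then have sq3: "(cmod (inverse_coeff f 3))\<^sup>2 \<le> K\<^sup>2 / 4"
      using power_mono[of "cmod (inverse_coeff f 3)" "\<bar>K\<bar> / 2" 2] by (simp add: power_divide)
    \<comment> \<open>\<open>E\<close> is the part of c_3 + \<sigma>3 c_1 c_2 + \<mu>3 c_1^3 free of
      \<open>d\<close>. The remaining term Y Z d is covered by the summand Y Z in
      \<open>cubic_bound\<close>.\<close>
    define E where "E = of_real \<mu>3 * a ^ 3 + of_real Y * (of_real \<sigma>3 * a * b - cnj a * b\<^sup>2)"
    have E: "cmod E + Y * Z \<le> \<mu>3"
      using cubic_bound[OF abd(1,2) assms(5)] by (simp add: E_def Y_def Z_def)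
    have "of_real (B 1) * (of_real Y * (of_real Z * d - cnj a * b\<^sup>2))
       + 2 * of_real K * a * (of_real Y * b) + of_real L * a ^ 3
       = of_real (B 1) * (E + of_real (Y * Z) * d)"
    proof -
      have "2 * complex_of_real K = of_real (B 1) * of_real \<sigma>3" "complex_of_real L = of_real (B 1) * of_real \<mu>3"
        using sig mu by (metis of_real_mult of_real_numeral)+
      then show ?thesis by (simp add: E_def algebra_simps)
    qed
    then have b4': "inverse_coeff f 4 = - (of_real (B 1) * (E + of_real (Y * Z) * d)) / 3"
      using b4 by simp
    have "cmod (E + of_real (Y * Z) * d) \<le> cmod E + Y * Z * cmod d"
      using norm_triangle_ineq[of E "of_real (Y * Z) * d"] YZ by (simp add: norm_mult)
    also have "\<dots> \<le> cmod E + Y * Z * 1"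
      using abd YZ by (intro add_left_mono mult_left_mono) auto
    finally have "cmod (E + of_real (Y * Z) * d) \<le> \<mu>3" using E by simp
    then have "B 1 * cmod (E + of_real (Y * Z) * d) \<le> L"
      using B1 by (simp flip: mu)
    then have "cmod (inverse_coeff f 4) \<le> L / 3"
      unfolding b4' using B1 by (simp add: norm_divide norm_mult)
    then have "(cmod (inverse_coeff f 4))\<^sup>2 \<le> L\<^sup>2 / 9"
      using power_mono[of "cmod (inverse_coeff f 4)" "L / 3" 2] by (simp add: power_divide)
    with sq3 show ?thesis
      using norm_triangle_ineq4[of "(inverse_coeff f 3)\<^sup>2" "(inverse_coeff f 4)\<^sup>2"]
      by (simp add: T22_inverse_def norm_power)
  qed
  moreover have "\<exists>f \<in> starlike_class \<phi>. cmod (T22_inverse f) = K\<^sup>2 / 4 + L\<^sup>2 / 9"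
  proof -
    obtain f where f: "f \<in> class_A" "\<And>z. z \<in> ball 0 1 \<Longrightarrow> starlike_quotient f z = \<phi> (\<i> * z)"
      using starlike_extremal_exists[OF hol p0, of \<i>] by auto
    have "f \<in> starlike_class \<phi>"
      using f starlike_quotient_subordinate[OF hol, of \<i>] by (simp add: starlike_class_def)
    moreover have "fps_expansion (\<lambda>z. \<i> * z) 0 = fps_const \<i> * fps_X"
      by (intro fps_expansion_eqI fps_expansion_intros)
    then have c: "taylor_coeff (\<lambda>z. \<i> * z) 1 = \<i>" "taylor_coeff (\<lambda>z. \<i> * z) 2 = 0" "taylor_coeff (\<lambda>z. \<i> * z) 3 = 0"
      by (simp_all add: taylor_coeff_def)
    have "(\<lambda>z. \<i> * z) holomorphic_on ball 0 1" by (intro holomorphic_intros)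
    note b = coeffs[OF f(1) this _ f(2), unfolded c]
    \<comment> \<open>The values come from c_1^2 = -1 and c_1^3 = -\<i>, with c_2 = c_3 = 0.\<close>
    have b34: "inverse_coeff f 3 = of_real K / 2" "inverse_coeff f 4 = \<i> * of_real L / 3"
      using b by (simp_all add: power3_eq_cube)
    then have "T22_inverse f = of_real (K\<^sup>2 / 4 + L\<^sup>2 / 9)"
      unfolding T22_inverse_def b34 by (simp add: power_divide power_mult_distrib)
    then have "cmod (T22_inverse f) = \<bar>K\<^sup>2 / 4 + L\<^sup>2 / 9\<bar>"
      by (simp only: norm_of_real)
    then have "cmod (T22_inverse f) = K\<^sup>2 / 4 + L\<^sup>2 / 9" by simp
    ultimately show ?thesis by blast
  qed
  ultimately show ?thesis unfolding K_def L_def by blast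
qed

end
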